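(* Let $\mathcal{T}$ be a tree on $n\ge 2$ vertices with geodesic distance sum $\mathcal{S}=\sum_{\{u,v\}}d(u,v)$ (over unordered pairs of distinct vertices), and let $m\ge 2$ be an integer. Let $\mathcal{T}^{m}(1)$ be the $m$th-order subdivision tree of $\mathcal{T}$, obtained by inserting $m$ new vertices into every edge of $\mathcal{T}$, i.e. replacing every edge $uv$ by a path from $u$ to $v$ of length $m+1$ whose $m$ internal vertices are new. Then the geodesic distance sum of $\mathcal{T}^{m}(1)$ is $$\mathcal{S}_{\mathcal{T}^{m}(1)}=(m+1)^{3}\mathcal{S}-\frac{2n^{2}\sum_{i=1}^{m}i^{3}}{m}+2n\sum_{i=1}^{m}i^{2}-\frac{m+1}{2m-1}\sum_{i=1}^{m-1}i^{2}.$$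
   Context: The geodesic distance $d(u,v)$ between two vertices of a tree is the length (number of edges) of the unique path joining them; the geodesic distance sum of a tree is the sum of $d(u,v)$ over all unordered pairs of distinct vertices. *)

theory Defs
  imports Complex_Main "Graph_Theory.Graph_Theory"
begin

text \<open>
  As in the Graph_Theory library, a finite simple undirected graph is a finite loop-free symmetric
  digraph whose arcs are pairs (\<open>pair_graph\<close>): the edge \<open>{u, v}\<close> is the pair of arcs
  \<open>(u, v)\<close>, \<open>(v, u)\<close>.

  The library's \<open>tree\<close> is not usable here: it forbids every directed cycle, including
  \<open>u, v, u\<close>, so no symmetric digraph with an edge satisfies it. In a loop-free digraph without
  parallel arcs, the directed cycles of length at least 3 are the cycles of the undirected graph.
\<close>

definition undirected_tree :: "'a pair_pre_digraph \<Rightarrow> bool" where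
  "undirected_tree T \<longleftrightarrow>
     pair_graph T \<and> Digraph_Component.connected (with_proj T) \<and>
     \<not> (\<exists>p. pre_digraph.cycle (with_proj T) p \<and> 3 \<le> length p)"

text \<open>
  A path is a list of arcs, so its length is its number of edges. The description is meaningful
  when the path from \<open>u\<close> to \<open>v\<close> is unique, as in a tree.
\<close>

definition geodesic_dist :: "'a pair_pre_digraph \<Rightarrow> 'a \<Rightarrow> 'a \<Rightarrow> nat" where
  "geodesic_dist T u v = length (THE p. pre_digraph.apath (with_proj T) u p v)"

text \<open>The distance of an unordered pair; well defined because the distance is symmetric.\<close>

definition pair_dist :: "'a pair_pre_digraph \<Rightarrow> 'a set \<Rightarrow> nat" where
  "pair_dist T P = (THE d. \<exists>u v. P = {u, v} \<and> d = geodesic_dist T u v)"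

definition geodesic_dist_sum :: "'a pair_pre_digraph \<Rightarrow> nat" where
  "geodesic_dist_sum T =
     (\<Sum>P \<in> {{u, v} | u v. u \<in> pverts T \<and> v \<in> pverts T \<and> u \<noteq> v}. pair_dist T P)"

text \<open>
  \<open>sub_vertex m u v i\<close> is the vertex at position \<open>i\<close> (\<open>0 \<le> i \<le> m + 1\<close>) on the path of length
  \<open>m + 1\<close> that replaces the edge \<open>{u, v}\<close>, counted from \<open>u\<close>. Old vertices are tagged with
  \<open>Inl\<close>. A new vertex is the set of its two descriptions, read from \<open>u\<close> and read from \<open>v\<close>, so
  that both orientations of an edge yield the same path.
\<close>

definition sub_vertex :: "nat \<Rightarrow> 'a \<Rightarrow> 'a \<Rightarrow> nat \<Rightarrow> 'a + ('a \<times> 'a \<times> nat) set" where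
  "sub_vertex m u v i =
     (if i = 0 then Inl u
      else if i = m + 1 then Inl v
      else Inr {(u, v, i), (v, u, m + 1 - i)})"

definition subdivision_tree ::
  "nat \<Rightarrow> 'a pair_pre_digraph \<Rightarrow> ('a + ('a \<times> 'a \<times> nat) set) pair_pre_digraph" where
  "subdivision_tree m T =
     \<lparr> pverts = Inl ` pverts T \<union> {sub_vertex m u v i | u v i. (u, v) \<in> parcs T \<and> 1 \<le> i \<and> i \<le> m},
       parcs = {(sub_vertex m u v i, sub_vertex m u v (i + 1)) | u v i. (u, v) \<in> parcs T \<and> i \<le> m} \<rparr>"

lemma sub_vertex_flip: "i \<le> m + 1 \<Longrightarrow> sub_vertex m v u (m + 1 - i) = sub_vertex m u v i"
  by (auto simp: sub_vertex_def)

lemma sub_vertex_new_eq_iff: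
  assumes "1 \<le> i" "i \<le> m" "1 \<le> j" "j \<le> m"
  shows "sub_vertex m u v i = sub_vertex m x y j \<longleftrightarrow>
         (u = x \<and> v = y \<and> i = j) \<or> (u = y \<and> v = x \<and> i = m + 1 - j)"
  using assms by (auto simp: sub_vertex_def doubleton_eq_iff)

lemma pair_graph_subdivision_tree:
  assumes "pair_graph T"
  shows "pair_graph (subdivision_tree m T)"
proof -
  interpret pair_graph T by fact
  let ?H = "subdivision_tree m T"
  have vert: "sub_vertex m u v i \<in> pverts ?H" if uvi: "(u, v) \<in> parcs T" "i \<le> m + 1" for u v i
  proof -
    consider "i = 0" | "i = m + 1" | "1 \<le> i" "i \<le> m" using uvi(2) by linarith
    then show ?thesis
    proof cases
      case 3
      then show ?thesis using uvi(1) by (simp add: subdivision_tree_def) blast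
    qed (use uvi in_arcsD1 in_arcsD2 in \<open>auto simp: subdivision_tree_def sub_vertex_def\<close>)
  qed
  have neq: "sub_vertex m u v i \<noteq> sub_vertex m u v (i + 1)"
    if "(u, v) \<in> parcs T" "i \<le> m" for u v i
    using that pair_no_loops[of "(u, v)"] by (auto simp: sub_vertex_def doubleton_eq_iff)
  have "{sub_vertex m u v i | u v i. (u, v) \<in> parcs T \<and> 1 \<le> i \<and> i \<le> m}
      \<subseteq> (\<lambda>((u, v), i). sub_vertex m u v i) ` (parcs T \<times> {..m})" by force
  then have "finite {sub_vertex m u v i | u v i. (u, v) \<in> parcs T \<and> 1 \<le> i \<and> i \<le> m}"
    by (rule finite_subset) (simp add: pair_finite_arcs)
  then have finv: "finite (pverts ?H)"
    by (simp add: subdivision_tree_def pair_finite_verts)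
  have arcs: "parcs ?H \<subseteq> pverts ?H \<times> pverts ?H"
  proof
    fix e assume "e \<in> parcs ?H"
    then obtain u v i where "e = (sub_vertex m u v i, sub_vertex m u v (i + 1))"
      "(u, v) \<in> parcs T" "i \<le> m" by (auto simp: subdivision_tree_def)
    then show "e \<in> pverts ?H \<times> pverts ?H" using vert[of u v i] vert[of u v "i + 1"] by simp
  qed
  have fina: "finite (parcs ?H)" by (rule finite_subset[OF arcs]) (simp add: finv)
  have symT: "(v, u) \<in> parcs T" if "(u, v) \<in> parcs T" for u v
    using that pair_sym_arcs by (auto simp: symmetric_def sym_def)
  have "sym (parcs ?H)"
  proof (rule symI)
    fix a b assume "(a, b) \<in> parcs ?H"
    then obtain u v i where *: "a = sub_vertex m u v i" "b = sub_vertex m u v (i + 1)"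
      "(u, v) \<in> parcs T" "i \<le> m" by (auto simp: subdivision_tree_def)
    have "b = sub_vertex m v u (m - i)" "a = sub_vertex m v u (m - i + 1)"
      using * sub_vertex_flip[of "i + 1" m v u] sub_vertex_flip[of i m v u]
      by (simp_all add: Suc_diff_le)
    then show "(b, a) \<in> parcs ?H"
      unfolding subdivision_tree_def using symT[OF *(3)] by fastforce
  qed
  then show ?thesis
    using arcs finv fina neq
    by unfold_locales (auto simp: symmetric_def, auto simp: subdivision_tree_def)
qed

end

theory Submission
  imports Defs
begin

text \<open>
  A symmetric loop-free digraph is a tree iff some root \<open>r\<close> carries a level function: a function
  that vanishes at \<open>r\<close>, changes by one along every edge, and gives every other vertex exactly one
  neighbour of lower level. It is then the distance from \<open>r\<close>. The level function of \<open>T\<close> extends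
  to the subdivision by linear interpolation, so the subdivision is a tree whose distances between
  old vertices are \<open>m + 1\<close> times the old ones.

  The distances of a vertex \<open>y\<close> to the new vertices of an edge \<open>u v\<close> form an arithmetic
  progression unless \<open>y\<close> is one of them, so they add up to \<open>m / 2\<close> times
  \<open>d(y, u) + d(y, v)\<close>; in the exceptional case they are \<open>\<bar>i - j\<bar>\<close>. This expresses the distance sum
  of the subdivision through the distances of \<open>y\<close> to old vertices, and a sum of
  \<open>d(r, u) + d(r, v)\<close> over the edges of \<open>T\<close> is a sum of \<open>2 d(r, x) - 1\<close> over the vertices
  \<open>x \<noteq> r\<close>.
\<close>

subsection \<open>Level functions and distances in trees\<close>

definition level_function :: "'a pair_pre_digraph \<Rightarrow> 'a \<Rightarrow> ('a \<Rightarrow> nat) \<Rightarrow> bool" where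
  "level_function G r f \<longleftrightarrow> r \<in> pverts G \<and> f r = 0 \<and>
     (\<forall>u v. (u, v) \<in> parcs G \<longrightarrow> f v = f u + 1 \<or> f u = f v + 1) \<and>
     (\<forall>x \<in> pverts G. x \<noteq> r \<longrightarrow> (\<exists>!y. (y, x) \<in> parcs G \<and> f x = f y + 1))"

lemma level_functionD:
  assumes "level_function G r f"
  shows "r \<in> pverts G" "f r = 0" "(u, v) \<in> parcs G \<Longrightarrow> f v = f u + 1 \<or> f u = f v + 1"
    "x \<in> pverts G \<Longrightarrow> x \<noteq> r \<Longrightarrow> \<exists>!y. (y, x) \<in> parcs G \<and> f x = f y + 1"
  using assms by (auto simp: level_function_def)

text \<open>Induction on the \<open>f\<close>-level. Let \<open>y\<close> be the
  \<open>f\<close>-parent of \<open>x\<close>, so that \<open>g y = f y\<close>. If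
  \<open>g x\<close> differed from \<open>f x\<close>, then \<open>x\<close> would lie below
  \<open>y\<close> in \<open>g\<close>. The \<open>f\<close>-parent \<open>z\<close> of
  \<open>y\<close> also lies below \<open>y\<close> in \<open>g\<close>, so uniqueness of the lower
  neighbour gives \<open>z = x\<close>, although \<open>f z < f x\<close>.\<close>

lemma level_function_unique:
  assumes G: "pair_wf_digraph G" and sym: "sym (parcs G)"
    and f: "level_function G r f" and g: "level_function G r g" and "x \<in> pverts G"
  shows "f x = g x"
  using \<open>x \<in> pverts G\<close>
proof (induction "f x" arbitrary: x rule: less_induct)
  case less
  interpret pair_wf_digraph G by fact
  note fD = level_functionD[OF f] and gD = level_functionD[OF g]
  show ?case
  proof (cases "x = r")
    case True
    then show ?thesis using fD(2) gD(2) by simp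
  next
    case False
    then obtain y where y: "(y, x) \<in> parcs G" "f x = f y + 1" using fD(4) less.prems by blast
    then have "y \<in> pverts G" and gy: "g y = f y" using less.hyps[of y] in_arcsD1 by auto
    show ?thesis
    proof (rule ccontr)
      assume "f x \<noteq> g x"
      then have gx: "g y = g x + 1" using gD(3)[OF y(1)] gy y(2) by auto
      then have "y \<noteq> r" using gD(2) by auto
      then obtain z where z: "(z, y) \<in> parcs G" "f y = f z + 1"
        using fD(4) \<open>y \<in> pverts G\<close> by blast
      then have "g z = f z" using less.hyps[of z] in_arcsD1 y by auto
      moreover have "(x, y) \<in> parcs G" using y sym by (auto dest: symD)
      ultimately have "z = x"
        using gD(4)[OF \<open>y \<in> pverts G\<close> \<open>y \<noteq> r\<close>] z gx gy by (metis (no_types))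
      then show False using y z by simp
    qed
  qed
qed

lemma (in pair_wf_digraph) level_function_awalk:
  assumes "level_function G r f" and "x \<in> pverts G"
  shows "\<exists>p. awalk r p x"
  using assms(2)
proof (induction "f x" arbitrary: x rule: less_induct)
  case less
  show ?case
  proof (cases "x = r")
    case True
    then show ?thesis using less.prems awalk_Nil_iff by blast
  next
    case False
    then obtain y where y: "(y, x) \<in> parcs G" "f x = f y + 1"
      using level_functionD(4)[OF assms(1)] less.prems by blast
    then obtain p where "awalk r p y" using less.hyps[of y] in_arcsD1 by auto
    moreover have "awalk y [(y, x)] x" using y in_arcsD1 in_arcsD2 by (auto simp: awalk_simps)
    ultimately show ?thesis by (metis awalk_appendI)
  qed
qed

text \<open>Connectedness is defined through the symmetric closure, which reaches nothing new when
  the arcs are already symmetric.\<close>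

lemma (in pair_graph) connected_iff_reachable:
  "Digraph_Component.connected (with_proj G) \<longleftrightarrow>
     pverts G \<noteq> {} \<and> (\<forall>u \<in> pverts G. \<forall>v \<in> pverts G. \<exists>p. awalk u p v)"
  unfolding Digraph_Component.connected_def strongly_connected_def
  using reachable_mk_symmetric_eq[OF pair_sym_arcs] reachable_awalk by auto

lemma (in pair_graph) parcs_sym: "sym (parcs G)"
  using pair_sym_arcs by (simp add: symmetric_def)

text \<open>A vertex of maximal level on a cycle would have two distinct lower neighbours.\<close>

lemma (in pair_graph) level_function_no_cycle:
  assumes f: "level_function G r f" and c: "cycle p" and len: "3 \<le> length p"
  shows False
proof -
  define k where "k = length p"
  obtain u where u: "awalk u p u" "distinct (tl (pawalk_verts u p))" "p \<noteq> []"
    using c by (auto simp: cycle_def)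
  have arcs: "set p \<subseteq> parcs G" and cas: "pcas u p u" using u(1) by (auto simp: awalk_def)
  have verts: "pawalk_verts u p = fst (hd p) # map snd p"
    "pawalk_verts u p = map fst p @ [snd (last p)]"
    using awalk_verts_conv'[OF cas] awalk_verts_conv[of u p] u(3) by simp_all
  have dist: "distinct (map snd p)" using u(2) verts(1) by simp
  have ends: "snd (last p) = fst (hd p)"
    using awhd_if_cas[OF cas] awlast_if_cas[OF cas] verts by (metis last_snoc list.sel(1))
  \<comment> \<open>Positions on the cycle are read modulo its length; at the last arc the step back
    to the start uses that the walk is closed.\<close>
  have nxt: "fst (p ! (Suc i mod k)) = snd (p ! i)" if "i < k" for i
  proof (cases "Suc i = k")
    case True
    then have "i = length p - 1" by (simp add: k_def)
    then show ?thesis using ends u(3) True k_def by (metis hd_conv_nth last_conv_nth mod_self)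
  next
    case False
    then have "Suc i < k" using that by simp
    moreover have "(map fst p @ [snd (last p)]) ! Suc i = (fst (hd p) # map snd p) ! Suc i"
      using verts by simp
    ultimately show ?thesis by (simp add: k_def nth_append)
  qed
  have k3: "3 \<le> k" using len k_def by simp
  let ?F = "(\<lambda>i. f (snd (p ! i))) ` {..<k}"
  have fin: "finite ?F" "?F \<noteq> {}" using k3 by (auto simp: lessThan_empty_iff)
  obtain i where i: "i < k" and "Max ?F = f (snd (p ! i))" using Max_in[OF fin] by auto
  then have max: "f (snd (p ! j)) \<le> f (snd (p ! i))" if "j < k" for j
    using Max_ge[OF fin(1), of "f (snd (p ! j))"] that by auto
  define b where "b = snd (p ! i)"
  \<comment> \<open>\<open>b\<close> is a vertex of maximal level. The arc with index
    \<open>h\<close> precedes the arc into \<open>b\<close> and the arc with index \<open>j\<close>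
    follows it, so their heads are the two neighbours of \<open>b\<close> on the cycle.\<close>
  define j where "j = Suc i mod k"
  define h where "h = (if i = 0 then k - 1 else i - 1)"
  have hj: "h < k" "j < k" "Suc h mod k = i" using i k3 by (auto simp: h_def j_def)
  \<comment> \<open>This is where length at least 3 enters: on a cycle \<open>u, v, u\<close> the
    two neighbours coincide.\<close>
  have "h \<noteq> j" using i k3 by (auto simp: h_def j_def mod_Suc split: if_splits)
  then have ne: "snd (p ! h) \<noteq> snd (p ! j)"
    using dist hj k_def by (metis length_map nth_eq_iff_index_eq nth_map)
  have "p ! i = (snd (p ! h), b)" "p ! j = (b, snd (p ! j))"
    using nxt[OF hj(1)] nxt[OF i] hj(3) by (auto simp: b_def j_def prod_eq_iff)
  then have e: "(snd (p ! h), b) \<in> parcs G" "(b, snd (p ! j)) \<in> parcs G"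
    using arcs i hj k_def by (metis nth_mem subsetD)+
  then have e2: "(snd (p ! j), b) \<in> parcs G" using parcs_sym by (auto dest: symD)
  have lower: "f b = f (snd (p ! h)) + 1" "f b = f (snd (p ! j)) + 1"
    using level_functionD(3)[OF f e(1)] level_functionD(3)[OF f e(2)] max[OF hj(1)] max[OF hj(2)]
    by (auto simp: b_def)
  then have "b \<noteq> r" using level_functionD(2)[OF f] by auto
  then show False
    using level_functionD(4)[OF f] e(1) e2 lower ne in_arcsD2 by blast
qed

text \<open>Any two vertices are joined by a walk through the root, and a maximal level on a cycle
  is impossible.\<close>

lemma undirected_tree_if_level_function:
  assumes "pair_graph G" "level_function G r f"
  shows "undirected_tree G"
proof -
  interpret pair_graph G by fact
  have "\<exists>p. awalk u p v" if "u \<in> pverts G" "v \<in> pverts G" for u v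
    using level_function_awalk[OF assms(2)] that awalk_rev_path awalk_appendI by metis
  then show ?thesis
    using assms level_function_no_cycle level_functionD(1)[OF assms(2)]
    by (auto simp: undirected_tree_def connected_iff_reachable)
qed

lemma length_rev_path: "length (rev_path p) = length p"
  by (induction p) auto

section \<open>Unique paths and distances in a tree\<close>

locale tree_graph = pair_graph T for T :: "'a pair_pre_digraph" +
  assumes tree: "undirected_tree T"
begin

text \<open>If \<open>y\<close> already lies on the path, the arc \<open>(y, x)\<close> closes the
  initial segment \<open>q\<close> from \<open>x\<close> to \<open>y\<close> into a cycle. Long
  cycles are excluded, so \<open>q\<close> is the single arc \<open>(x, y)\<close>. Hence moving to
  a neighbour lengthens or shortens the path by exactly one arc.\<close>

lemma apath_step_cases:
  assumes "apath x p r" and "(y, x) \<in> parcs T"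
  obtains "apath y ((y, x) # p) r"
  | p' where "p = (x, y) # p'" "apath y p' r"
proof (cases "y \<in> set (pawalk_verts x p)")
  case False
  then show ?thesis using that(1) assms by (auto simp: apath_simps)
next
  case True
  then obtain q s where qs: "p = q @ s" "awalk x q y" "awalk y s r"
    using awalk_decomp[of x p r y] assms(1) by (auto simp: apath_def)
  have "awalk y ((y, x) # q) y" using qs(2) assms(2) by (auto simp: awalk_simps)
  moreover have dist: "distinct (pawalk_verts x q)"
    using assms(1) qs apath_append_iff[of x q s r] by (auto simp: apath_def)
  ultimately have "cycle ((y, x) # q)" by (auto simp: cycle_def)
  then have "length q \<le> 1" using tree by (fastforce simp: undirected_tree_def)
  moreover have "q \<noteq> []" using qs(2) no_loops'[OF assms(2)] by (auto simp: awalk_Nil_iff)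
  ultimately obtain e where "q = [e]" by (cases q) auto
  then have q: "q = [(x, y)]" using qs(2) by (cases e) (auto simp: awalk_simps)
  then have "apath y s r" using assms(1) qs by (auto simp: apath_simps)
  then show ?thesis using that(2) q qs(1) by simp
qed

lemma apath_unique:
  assumes "apath x p r" "apath x q r"
  shows "p = q"
  using assms
proof (induction p arbitrary: x q)
  case Nil
  then show ?case by (metis apath_nonempty_ends apath_Nil_iff)
next
  case (Cons e p)
  obtain y where e: "e = (x, y)" using Cons.prems by (cases e) (auto simp: apath_simps)
  have y: "(x, y) \<in> parcs T" "apath y p r" "x \<notin> set (pawalk_verts y p)"
    using Cons.prems e by (auto simp: apath_simps)
  then have "(y, x) \<in> parcs T" using parcs_sym by (auto dest: symD)
  with Cons.prems(2) show ?case
  proof (cases rule: apath_step_cases)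
    case 1
    \<comment> \<open>This alternative is contradictory: \<open>p\<close> would pass through
      \<open>x\<close>, which a path starting with \<open>(x, y) # p\<close> may not
      revisit.\<close>
    then have "p = (y, x) # q" using Cons.IH y by blast
    then show ?thesis using y Cons.prems(2) by (cases q) (auto simp: apath_simps)
  next
    case (2 q')
    then show ?thesis using Cons.IH[OF y(2)] e by auto
  qed
qed

lemma ex_apath: "x \<in> pverts T \<Longrightarrow> r \<in> pverts T \<Longrightarrow> \<exists>p. apath x p r"
  using tree connected_iff_reachable apath_awalk_to_apath by (metis undirected_tree_def)

lemma geodesic_dist_eq: "apath x p r \<Longrightarrow> geodesic_dist T x r = length p"
  unfolding geodesic_dist_def using apath_unique by (metis the_equality)

lemma geodesic_dist_sym:
  assumes "x \<in> pverts T" "r \<in> pverts T"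
  shows "geodesic_dist T x r = geodesic_dist T r x"
  using ex_apath[OF assms] geodesic_dist_eq apath_rev_path length_rev_path by metis

lemma level_function_geodesic_dist:
  assumes r: "r \<in> pverts T"
  shows "level_function T r (geodesic_dist T r)"
proof -
  \<comment> \<open>Distances are taken towards \<open>r\<close> because lists of arcs grow at the
    front; symmetry turns them round at the end.\<close>
  define f where "f x = geodesic_dist T x r" for x
  have f: "f x = length p" if "apath x p r" for x p
    using geodesic_dist_eq that by (simp add: f_def)
  have step: "f v = f u + 1 \<or> f u = f v + 1" if uv: "(u, v) \<in> parcs T" for u v
  proof -
    obtain p where p: "apath v p r" using ex_apath r uv in_arcsD2 by blast
    show ?thesis using p uv by (cases rule: apath_step_cases) (use f p in auto)
  qed
  \<comment> \<open>A lower neighbour must be the second vertex of the path from \<open>x\<close> to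
    \<open>r\<close>. Uniqueness of that path therefore gives uniqueness of the parent.\<close>
  have low: "\<exists>p. apath y p r \<and> apath x ((x, y) # p) r" if yx: "(y, x) \<in> parcs T" "f x = f y + 1" for x y
  proof -
    obtain p where p: "apath x p r" using ex_apath r yx in_arcsD2 by blast
    show ?thesis using p yx(1) by (cases rule: apath_step_cases) (use f p yx in auto)
  qed
  have "\<exists>!y. (y, x) \<in> parcs T \<and> f x = f y + 1" if x: "x \<in> pverts T" "x \<noteq> r" for x
  proof (rule ex_ex1I)
    obtain p where p: "apath x p r" using ex_apath r x by blast
    then obtain e q where "p = e # q" using x by (cases p) (auto simp: apath_Nil_iff)
    then obtain y where y: "p = (x, y) # q" using p by (cases e) (auto simp: apath_simps)
    then have "(x, y) \<in> parcs T" "apath y q r" using p by (auto simp: apath_simps)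
    then show "\<exists>y. (y, x) \<in> parcs T \<and> f x = f y + 1"
      using f[OF p] f y parcs_sym by (auto dest: symD)
  next
    fix y z assume "(y, x) \<in> parcs T \<and> f x = f y + 1" "(z, x) \<in> parcs T \<and> f x = f z + 1"
    then show "y = z" using low apath_unique by (metis list.inject prod.inject)
  qed
  moreover have "f r = 0" using f[of r "[]"] r by (simp add: apath_Nil_iff)
  ultimately have "level_function T r f" using step r by (auto simp: level_function_def)
  moreover have "geodesic_dist T r x = f x" if "x \<in> pverts T" for x
    using geodesic_dist_sym r that by (simp add: f_def)
  ultimately show ?thesis
    using in_arcsD1 in_arcsD2 by (simp add: level_function_def) metis
qed

text \<open>Distances from \<open>r\<close> form a level function and level functions are unique, so
  exhibiting any level function computes distances without handling paths.\<close>

lemma geodesic_dist_eq_level: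
  assumes "level_function T r f" "x \<in> pverts T"
  shows "geodesic_dist T r x = f x"
  using level_function_unique[OF pair_wf_digraph parcs_sym level_function_geodesic_dist assms(1) assms(2)]
    level_functionD(1)[OF assms(1)] by blast

lemma pair_dist_eq:
  assumes "u \<in> pverts T" "v \<in> pverts T"
  shows "pair_dist T {u, v} = geodesic_dist T u v"
  unfolding pair_dist_def
  by (rule the_equality) (use geodesic_dist_sym assms in \<open>auto simp: doubleton_eq_iff\<close>)

lemma geodesic_dist_self: "u \<in> pverts T \<Longrightarrow> geodesic_dist T u u = 0"
  using level_functionD(2)[OF level_function_geodesic_dist] .

lemma sum_geodesic_dist:
  "(\<Sum>u\<in>pverts T. \<Sum>v\<in>pverts T. geodesic_dist T u v) = 2 * geodesic_dist_sum T"
proof -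
  let ?V = "pverts T" and ?d = "geodesic_dist T"
  let ?A = "{(u, v). u \<in> ?V \<and> v \<in> ?V \<and> u \<noteq> v}"
  let ?P = "{{u, v} | u v. u \<in> ?V \<and> v \<in> ?V \<and> u \<noteq> v}"
  have A: "?A = ?V \<times> ?V - (\<lambda>u. (u, u)) ` ?V" by auto
  then have fin: "finite ?A" using pair_finite_verts by simp
  have im: "(\<lambda>(u, v). {u, v}) ` ?A = ?P" by auto
  have "(\<Sum>u\<in>?V. \<Sum>v\<in>?V. ?d u v) = (\<Sum>(u, v)\<in>?V \<times> ?V. ?d u v)"
    by (simp add: sum.cartesian_product)
  also have "\<dots> = (\<Sum>(u, v)\<in>?A. ?d u v)"
    by (rule sum.mono_neutral_right) (auto simp: geodesic_dist_self pair_finite_verts)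
  \<comment> \<open>Ordered pairs are grouped by their underlying unordered pair; each group
    consists of the two orders.\<close>
  also have "\<dots> = (\<Sum>P\<in>?P. \<Sum>(u, v)\<in>{e \<in> ?A. (\<lambda>(u, v). {u, v}) e = P}. ?d u v)"
    using sum.image_gen[OF fin, of "\<lambda>(u, v). ?d u v" "\<lambda>(u, v). {u, v}"] im by simp
  also have "\<dots> = (\<Sum>P\<in>?P. 2 * pair_dist T P)"
  proof (rule sum.cong[OF refl])
    fix P assume "P \<in> ?P"
    then obtain u v where uv: "P = {u, v}" "u \<in> ?V" "v \<in> ?V" "u \<noteq> v" by blast
    then have "{e \<in> ?A. (\<lambda>(u, v). {u, v}) e = P} = {(u, v), (v, u)}"
      by (auto simp: doubleton_eq_iff)
    then show "(\<Sum>(u, v)\<in>{e \<in> ?A. (\<lambda>(u, v). {u, v}) e = P}. ?d u v) = 2 * pair_dist T P"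
      using uv pair_dist_eq geodesic_dist_sym[of u v] by simp
  qed
  finally show ?thesis by (simp add: geodesic_dist_sum_def sum_distrib_left)
qed

end

subsection \<open>Level functions of the subdivision\<close>

text \<open>
  The two descriptions of a new vertex, read from the two ends of its edge, give different values;
  the smaller one belongs to the end of lower level.
\<close>

definition sub_level :: "nat \<Rightarrow> ('a \<Rightarrow> nat) \<Rightarrow> 'a + ('a \<times> 'a \<times> nat) set \<Rightarrow> nat" where
  "sub_level m f y = (case y of
     Inl x \<Rightarrow> (m + 1) * f x
   | Inr S \<Rightarrow> Min ((\<lambda>(u, v, i). (m + 1) * f u + i) ` S))"

text \<open>Read from the upper end \<open>v\<close>, an inner position has the value
  \<open>(m + 1) * f u + 2 * (m + 1) - i\<close>, which is not smaller, so the minimum selects the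
  reading from \<open>u\<close>.\<close>

lemma sub_level_sub_vertex:
  assumes "f v = f u + 1" "i \<le> m + 1"
  shows "sub_level m f (sub_vertex m u v i) = (m + 1) * f u + i"
  using assms by (auto simp: sub_level_def sub_vertex_def algebra_simps)

text \<open>Upward edges have only one reading, which removes the flip ambiguity. Starting at
  position 1 assigns an old vertex only to the edge from its parent, at position
  \<open>m + 1\<close>. Together this gives normal forms for the vertices other than the
  root.\<close>

lemma sub_vertex_eq_iff_upward:
  assumes f: "level_function G r f" and "(u, v) \<in> parcs G" "f v = f u + 1"
    and "(x, y) \<in> parcs G" "f y = f x + 1"
    and "1 \<le> i" "i \<le> m + 1" "1 \<le> j" "j \<le> m + 1" and "v \<in> pverts G"
  shows "sub_vertex m u v i = sub_vertex m x y j \<longleftrightarrow> u = x \<and> v = y \<and> i = j"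
proof
  assume eq: "sub_vertex m u v i = sub_vertex m x y j"
  show "u = x \<and> v = y \<and> i = j"
  proof (cases "i = m + 1")
    case True
    then have "j = m + 1" "v = y" using eq assms by (auto simp: sub_vertex_def split: if_splits)
    moreover have "v \<noteq> r" using assms(3) level_functionD(2)[OF f] by auto
    ultimately show ?thesis using level_functionD(4)[OF f \<open>v \<in> pverts G\<close>] assms True by auto
  next
    case False
    then have "j \<noteq> m + 1" using eq assms by (auto simp: sub_vertex_def split: if_splits)
    with False show ?thesis using eq sub_vertex_new_eq_iff[of i m j u v x y] assms by auto
  qed
qed simp

context pair_graph
begin

lemma sub_vertex_in_pverts:
  assumes "(u, v) \<in> parcs G" "i \<le> m + 1"
  shows "sub_vertex m u v i \<in> pverts (subdivision_tree m G)"
proof -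
  consider "i = 0" | "i = m + 1" | "1 \<le> i" "i \<le> m" using assms(2) by linarith
  then show ?thesis
  proof cases
    case 3
    then show ?thesis using assms(1) by (simp add: subdivision_tree_def) blast
  qed (use assms in_arcsD1 in_arcsD2 in \<open>auto simp: subdivision_tree_def sub_vertex_def\<close>)
qed

lemma subdivision_arc_upward:
  assumes f: "level_function G r f" and "(a, b) \<in> parcs (subdivision_tree m G)"
  obtains u v i where "(u, v) \<in> parcs G" "f v = f u + 1" "i \<le> m"
    "(a, b) = (sub_vertex m u v i, sub_vertex m u v (i + 1)) \<or>
     (b, a) = (sub_vertex m u v i, sub_vertex m u v (i + 1))"
proof -
  obtain u v i where uvi: "(u, v) \<in> parcs G" "i \<le> m"
    "a = sub_vertex m u v i" "b = sub_vertex m u v (i + 1)"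
    using assms(2) by (auto simp: subdivision_tree_def)
  show thesis
  proof (cases "f v = f u + 1")
    case True
    then show thesis using that uvi by blast
  next
    case False
    then have "f u = f v + 1" using level_functionD(3)[OF f uvi(1)] by auto
    moreover have "(v, u) \<in> parcs G" using uvi(1) parcs_sym by (auto dest: symD)
    moreover have "b = sub_vertex m v u (m - i)" "a = sub_vertex m v u (m - i + 1)"
      using uvi sub_vertex_flip[of "i + 1" m v u] sub_vertex_flip[of i m v u]
      by (simp_all add: Suc_diff_le)
    ultimately show thesis using that[of v u "m - i"] by auto
  qed
qed

lemma subdivision_vertex_upward:
  assumes f: "level_function G r f" and "y \<in> pverts (subdivision_tree m G)" "y \<noteq> Inl r"
  obtains u v i where "(u, v) \<in> parcs G" "f v = f u + 1" "1 \<le> i" "i \<le> m + 1"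
    "y = sub_vertex m u v i"
proof -
  consider x where "y = Inl x" "x \<in> pverts G" "x \<noteq> r"
    | u v i where "(u, v) \<in> parcs G" "1 \<le> i" "i \<le> m" "y = sub_vertex m u v i"
    using assms(2,3) by (auto simp: subdivision_tree_def)
  then show thesis
  proof cases
    case (1 x)
    then obtain u where "(u, x) \<in> parcs G" "f x = f u + 1"
      using level_functionD(4)[OF f] by blast
    then show thesis using that[of u x "m + 1"] 1(1) by (simp add: sub_vertex_def)
  next
    case (2 u v i)
    show thesis
    proof (cases "f v = f u + 1")
      case True
      then show thesis using that 2 by simp
    next
      case False
      then have "f u = f v + 1" using level_functionD(3)[OF f 2(1)] by auto
      moreover have "(v, u) \<in> parcs G" using 2(1) parcs_sym by (auto dest: symD)
      ultimately show thesis using that[of v u "m + 1 - i"] 2 sub_vertex_flip[of i m v u] by simp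
    qed
  qed
qed

text \<open>In the normal form on upward edges, the parent of position \<open>i\<close> is position
  \<open>i - 1\<close>; a competing lower neighbour yields a second normal form of the same
  vertex.\<close>

lemma level_function_subdivision:
  assumes f: "level_function G r f"
  shows "level_function (subdivision_tree m G) (Inl r) (sub_level m f)"
proof -
  let ?H = "subdivision_tree m G" and ?g = "sub_level m f"
  have "?g b = ?g a + 1 \<or> ?g a = ?g b + 1" if "(a, b) \<in> parcs ?H" for a b
    using f that by (rule subdivision_arc_upward) (auto simp: sub_level_sub_vertex)
  moreover have "\<exists>!a. (a, y) \<in> parcs ?H \<and> ?g y = ?g a + 1"
    if y: "y \<in> pverts ?H" "y \<noteq> Inl r" for y
  proof -
    obtain u v i where uvi: "(u, v) \<in> parcs G" "f v = f u + 1" "1 \<le> i" "i \<le> m + 1"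
      "y = sub_vertex m u v i" using f y by (rule subdivision_vertex_upward)
    have gy: "?g y = (m + 1) * f u + i" using uvi by (simp add: sub_level_sub_vertex)
    show ?thesis
    proof (rule ex1I[of _ "sub_vertex m u v (i - 1)"])
      have "y = sub_vertex m u v (i - 1 + 1)" "i - 1 \<le> m" using uvi by simp_all
      then have "(sub_vertex m u v (i - 1), y) \<in> parcs ?H"
        using uvi(1) unfolding subdivision_tree_def by auto
      then show "(sub_vertex m u v (i - 1), y) \<in> parcs ?H \<and> ?g y = ?g (sub_vertex m u v (i - 1)) + 1"
        using uvi gy by (simp add: sub_level_sub_vertex)
    next
      fix a assume a: "(a, y) \<in> parcs ?H \<and> ?g y = ?g a + 1"
      obtain w x j where wxj: "(w, x) \<in> parcs G" "f x = f w + 1" "j \<le> m"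
        "(a, y) = (sub_vertex m w x j, sub_vertex m w x (j + 1)) \<or>
         (y, a) = (sub_vertex m w x j, sub_vertex m w x (j + 1))"
        using f conjunct1[OF a] by (rule subdivision_arc_upward)
      then have eq: "y = sub_vertex m w x (j + 1)" "a = sub_vertex m w x j"
        using a by (auto simp: sub_level_sub_vertex)
      then have "u = w \<and> v = x \<and> i = j + 1"
        using sub_vertex_eq_iff_upward[OF f uvi(1,2) wxj(1,2) uvi(3,4), of "j + 1"] uvi wxj in_arcsD2
        by simp
      then show "a = sub_vertex m u v (i - 1)" using eq by simp
    qed
  qed
  moreover have "Inl r \<in> pverts ?H" "?g (Inl r) = 0"
    using level_functionD(1,2)[OF f] by (auto simp: subdivision_tree_def sub_level_def)
  ultimately show ?thesis unfolding level_function_def by blast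
qed

section \<open>The path replacing an edge, and sums over the vertices of the subdivision\<close>

lemma sub_vertex_neighbours:
  assumes "(a, sub_vertex m u v i) \<in> parcs (subdivision_tree m G)" "1 \<le> i" "i \<le> m"
  shows "a = sub_vertex m u v (i - 1) \<or> a = sub_vertex m u v (i + 1)"
proof -
  obtain x y j where xyj: "(x, y) \<in> parcs G" "j \<le> m" "a = sub_vertex m x y j"
    "sub_vertex m u v i = sub_vertex m x y (j + 1)"
    using assms(1) by (auto simp: subdivision_tree_def)
  then have "j + 1 \<le> m" using assms(2,3) by (auto simp: sub_vertex_def split: if_splits)
  then consider "u = x" "v = y" "i = j + 1" | "u = y" "v = x" "i = m + 1 - (j + 1)"
    using xyj(4) sub_vertex_new_eq_iff[of i m "j + 1" u v x y] assms(2,3) by auto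
  then show ?thesis
  proof cases
    \<comment> \<open>The arc runs along the edge in the opposite direction, so its tail is the next
      position when counted from \<open>u\<close>.\<close>
    case 2
    then have i: "i + 1 = m + 1 - j" using \<open>j + 1 \<le> m\<close> by simp
    have "a = sub_vertex m u v (i + 1)"
      unfolding i using sub_vertex_flip[of j m u v] 2 xyj(2,3) by simp
    then show ?thesis ..
  qed (simp add: xyj(3))
qed

lemma sub_vertex_inj:
  assumes "(u, v) \<in> parcs G"
  shows "inj_on (sub_vertex m u v) {..m + 1}"
proof (rule inj_onI)
  fix i j assume "i \<in> {..m + 1}" "j \<in> {..m + 1}" "sub_vertex m u v i = sub_vertex m u v j"
  then show "i = j"
    using no_loops'[OF assms] by (auto simp: sub_vertex_def doubleton_eq_iff split: if_splits)
qed

text \<open>Each new vertex is reached from exactly two triples, one for each orientation of its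
  edge, hence the division by 2.\<close>

lemma sum_subdivision_vertices:
  fixes F :: "'a + ('a \<times> 'a \<times> nat) set \<Rightarrow> real"
  shows "(\<Sum>y\<in>pverts (subdivision_tree m G). F y) =
    (\<Sum>x\<in>pverts G. F (Inl x)) + (\<Sum>(u, v)\<in>parcs G. \<Sum>i=1..m. F (sub_vertex m u v i)) / 2"
proof -
  define h where "h = (\<lambda>((u, v), i). sub_vertex m u v i :: 'a + ('a \<times> 'a \<times> nat) set)"
  let ?A = "parcs G \<times> {1..m}"
  have V: "pverts (subdivision_tree m G) = Inl ` pverts G \<union> h ` ?A"
    by (force simp: subdivision_tree_def h_def image_def)
  have fibre: "(\<Sum>e\<in>{e \<in> ?A. h e = y}. F (h e)) = 2 * F y" if "y \<in> h ` ?A" for y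
  proof -
    obtain u v i where uvi: "(u, v) \<in> parcs G" "1 \<le> i" "i \<le> m" "y = sub_vertex m u v i"
      using \<open>y \<in> h ` ?A\<close> by (auto simp: h_def)
    have vu: "(v, u) \<in> parcs G" using uvi(1) parcs_sym by (auto dest: symD)
    have "{e \<in> ?A. h e = y} = {((u, v), i), ((v, u), m + 1 - i)}"
      using uvi vu by (auto simp: h_def sub_vertex_new_eq_iff)
    moreover have "((u, v), i) \<noteq> ((v, u), m + 1 - i)" using no_loops'[OF uvi(1)] by auto
    moreover have "h ((u, v), i) = y" "h ((v, u), m + 1 - i) = y"
      using uvi sub_vertex_flip[of i m v u] by (simp_all add: h_def)
    ultimately show ?thesis by simp
  qed
  have "(\<Sum>(u, v)\<in>parcs G. \<Sum>i=1..m. F (sub_vertex m u v i)) = (\<Sum>e\<in>?A. F (h e))"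
    by (simp add: sum.cartesian_product h_def split_def)
  also have "\<dots> = (\<Sum>y\<in>h ` ?A. \<Sum>e\<in>{e \<in> ?A. h e = y}. F (h e))"
    by (rule sum.image_gen) (simp add: pair_finite_arcs)
  also have "\<dots> = (\<Sum>y\<in>h ` ?A. 2 * F y)" using fibre by (rule sum.cong[OF refl])
  also have "\<dots> = 2 * (\<Sum>y\<in>h ` ?A. F y)" by (simp add: sum_distrib_left)
  finally have "(\<Sum>y\<in>h ` ?A. F y) = (\<Sum>(u, v)\<in>parcs G. \<Sum>i=1..m. F (sub_vertex m u v i)) / 2"
    by simp
  moreover have "Inl ` pverts G \<inter> h ` ?A = {}" by (auto simp: h_def sub_vertex_def)
  then have "(\<Sum>y\<in>pverts (subdivision_tree m G). F y) = (\<Sum>y\<in>Inl ` pverts G. F y) + (\<Sum>y\<in>h ` ?A. F y)"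
    unfolding V by (intro sum.union_disjoint) (simp_all add: pair_finite_verts pair_finite_arcs)
  ultimately show ?thesis by (simp add: sum.reindex)
qed

text \<open>
  An inner vertex of the path other than the root has exactly one lower neighbour, so the level
  has no local extremum there.
\<close>

lemma level_function_along_path:
  fixes x :: "nat \<Rightarrow> 'a"
  assumes f: "level_function G r f"
    and arcs: "\<And>i. i < k \<Longrightarrow> (x i, x (Suc i)) \<in> parcs G"
    and inner: "\<And>i. 0 < i \<Longrightarrow> i < k \<Longrightarrow> x i \<noteq> r \<and> x (i - 1) \<noteq> x (Suc i)"
    and nbs: "\<And>i a. 0 < i \<Longrightarrow> i < k \<Longrightarrow> (a, x i) \<in> parcs G \<Longrightarrow> a = x (i - 1) \<or> a = x (Suc i)"
  obtains s :: real where "s = 1 \<or> s = -1" "\<And>i. i \<le> k \<Longrightarrow> f (x i) = f (x 0) + s * i"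
proof -
  define s where "s = real (f (x 1)) - real (f (x 0))"
  have step: "real (f (x (Suc i))) - f (x i) = s" if "i < k" for i
    using that
  proof (induction i)
    case 0
    then show ?case by (simp add: s_def)
  next
    case (Suc i)
    have e: "(x i, x (Suc i)) \<in> parcs G" "(x (Suc (Suc i)), x (Suc i)) \<in> parcs G"
      using arcs[of i] arcs[of "Suc i"] Suc.prems parcs_sym by (auto dest: symD)
    have ne: "x (Suc i) \<noteq> r" "x i \<noteq> x (Suc (Suc i))" using inner[of "Suc i"] Suc.prems by auto
    then obtain a where a: "(a, x (Suc i)) \<in> parcs G" "f (x (Suc i)) = f a + 1"
      and a_eq: "\<And>b. (b, x (Suc i)) \<in> parcs G \<Longrightarrow> f (x (Suc i)) = f b + 1 \<Longrightarrow> b = a"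
      using level_functionD(4)[OF f] in_arcsD2[OF e(1)] by metis
    \<comment> \<open>Exactly one of the two neighbours is the parent, so the level keeps rising or
      keeps falling through \<open>x (Suc i)\<close>.\<close>
    have "f (x (Suc i)) = f (x i) + 1 \<longleftrightarrow> f (x (Suc i)) \<noteq> f (x (Suc (Suc i))) + 1"
    proof -
      have "a = x i \<or> a = x (Suc (Suc i))" using nbs[of "Suc i" a] Suc.prems a(1) by simp
      then show ?thesis using a(2) a_eq[OF e(1)] a_eq[OF e(2)] ne(2) by metis
    qed
    moreover have "real (f (x (Suc i))) - real (f (x i)) = s" using Suc by simp
    ultimately show ?case
      using level_functionD(3)[OF f e(1)] level_functionD(3)[OF f e(2)] by linarith
  qed
  have lin: "real (f (x i)) = f (x 0) + s * i" if "i \<le> k" for i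
    using that
  proof (induction i)
    case (Suc i)
    then show ?case using step[of i] by (simp add: algebra_simps)
  qed simp
  show thesis
  \<comment> \<open>Without arcs there is no increment to fix the sign, and \<open>1\<close> serves
    as an arbitrary choice.\<close>
  proof (cases "k = 0")
    case True
    then show thesis using that[of 1] by simp
  next
    case False
    then have "s = 1 \<or> s = -1"
      using level_functionD(3)[OF f arcs[of 0]] by (auto simp: s_def)
    then show thesis using that lin by blast
  qed
qed

end

text \<open>Twice the distance sum of a path on \<open>m\<close> vertices. Adding one more vertex
  contributes its row and its column.\<close>

lemma sum_abs_diff:
  "(\<Sum>i=1..m. \<Sum>j=1..m. \<bar>real i - real j\<bar>) = real m * (real m ^ 2 - 1) / 3"
proof (induction m)
  case (Suc m)
  have row: "(\<Sum>i=1..m. real (Suc m) - real i) = real m * (real m + 1) / 2" for m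
    by (induction m) (simp_all add: sum.distrib sum_subtractf field_simps)
  have abs: "(\<Sum>i=1..m. \<bar>real (Suc m) - real i\<bar>) = (\<Sum>i=1..m. real (Suc m) - real i)"
    by (rule sum.cong) auto
  have "(\<Sum>i=1..Suc m. \<Sum>j=1..Suc m. \<bar>real i - real j\<bar>) =
    (\<Sum>i=1..m. \<Sum>j=1..m. \<bar>real i - real j\<bar>) + 2 * (\<Sum>i=1..m. \<bar>real (Suc m) - real i\<bar>)"
    by (simp add: sum.distrib abs_minus_commute)
  then show ?case using Suc unfolding abs row by (simp add: field_simps power2_eq_square)
qed simp

subsection \<open>Distances in the subdivision\<close>

context tree_graph
begin

lemma pverts_nonempty: "pverts T \<noteq> {}"
  using tree connected_iff_reachable by (simp add: undirected_tree_def)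

lemma tree_graph_subdivision: "tree_graph (subdivision_tree m T)"
proof -
  obtain r where "r \<in> pverts T" using pverts_nonempty by blast
  then have "undirected_tree (subdivision_tree m T)"
    using undirected_tree_if_level_function[OF pair_graph_subdivision_tree[OF pair_graph]]
      level_function_subdivision level_function_geodesic_dist by blast
  then show ?thesis
    using pair_graph_subdivision_tree[OF pair_graph]
    by (simp add: tree_graph_def tree_graph_axioms_def)
qed

text \<open>Every edge is \<open>{x, y}\<close> for a unique vertex \<open>x\<close> other than the root and its parent \<open>y\<close>.\<close>

lemma sum_parcs_level:
  fixes F :: "real \<Rightarrow> real"
  assumes f: "level_function T r f"
  shows "(\<Sum>(u, v)\<in>parcs T. F (f u + f v)) = 2 * (\<Sum>x\<in>pverts T - {r}. F (2 * real (f x) - 1))"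
proof -
  define U where "U = {(u, v) \<in> parcs T. f v = f u + 1}"
  let ?F = "\<lambda>(u, v). F (f u + f v)"
  have E: "parcs T = U \<union> prod.swap ` U"
  proof -
    have "e \<in> U \<union> prod.swap ` U" if "e \<in> parcs T" for e
    proof -
      obtain u v where e: "e = (u, v)" by (cases e)
      then have "(u, v) \<in> U \<or> (v, u) \<in> U"
        using that level_functionD(3)[OF f, of u v] symD[OF parcs_sym, of u v] by (auto simp: U_def)
      moreover have "(u, v) \<in> prod.swap ` U" if "(v, u) \<in> U"
        using that by (intro image_eqI[of _ _ "(v, u)"]) simp_all
      ultimately show ?thesis using e by blast
    qed
    then show ?thesis using symD[OF parcs_sym] by (auto simp: U_def)
  qed
  have "finite U" by (rule finite_subset[OF _ pair_finite_arcs]) (auto simp: U_def)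
  moreover have "U \<inter> prod.swap ` U = {}" by (auto simp: U_def)
  ultimately have "sum ?F (parcs T) = sum ?F U + sum ?F (prod.swap ` U)"
    unfolding E by (intro sum.union_disjoint) simp_all
  also have "sum ?F (prod.swap ` U) = sum ?F U"
    by (subst sum.reindex) (auto simp: split_def add.commute intro: sum.cong)
  also have "sum ?F U = (\<Sum>x\<in>pverts T - {r}. F (2 * real (f x) - 1))"
  proof -
    have inj: "inj_on snd U"
    proof (rule inj_onI)
      fix e e' assume "e \<in> U" "e' \<in> U" and eq: "snd e = snd e'"
      then obtain u u' v where e: "e = (u, v)" "e' = (u', v)"
        "(u, v) \<in> parcs T" "f v = f u + 1" "(u', v) \<in> parcs T" "f v = f u' + 1"
        by (auto simp: U_def)
      then have "v \<in> pverts T" "v \<noteq> r" using level_functionD(2)[OF f] in_arcsD2 by auto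
      then show "e = e'" using level_functionD(4)[OF f] e by blast
    qed
    have im: "snd ` U = pverts T - {r}"
    proof (intro equalityI subsetI)
      fix x assume "x \<in> snd ` U"
      then show "x \<in> pverts T - {r}"
        using level_functionD(2)[OF f] in_arcsD2 by (auto simp: U_def)
    next
      fix x assume "x \<in> pverts T - {r}"
      then obtain y where "(y, x) \<in> parcs T" "f x = f y + 1"
        using level_functionD(4)[OF f] by blast
      then show "x \<in> snd ` U" by (intro image_eqI[of _ _ "(y, x)"]) (auto simp: U_def)
    qed
    have "sum ?F U = (\<Sum>e\<in>U. F (2 * real (f (snd e)) - 1))"
      by (rule sum.cong) (auto simp: U_def add.commute)
    then show ?thesis using sum.reindex[OF inj, of "\<lambda>x. F (2 * real (f x) - 1)"] im by simp
  qed
  finally show ?thesis by simp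
qed

text \<open>The constant function 1 turns the sum over arcs into a count: two arcs for every vertex
  other than the root.\<close>

lemma card_parcs: "real (card (parcs T)) = 2 * (real (card (pverts T)) - 1)"
proof -
  obtain r where r: "r \<in> pverts T" using pverts_nonempty by blast
  have "1 \<le> card (pverts T)" using r pair_finite_verts by (metis One_nat_def Suc_leI card_gt_0_iff empty_iff)
  then show ?thesis
    using sum_parcs_level[OF level_function_geodesic_dist[OF r], of "\<lambda>_. 1"] r pair_finite_verts
    by (simp add: split_def of_nat_diff)
qed

lemma sum_parcs_geodesic_dist:
  assumes r: "r \<in> pverts T"
  shows "(\<Sum>(u, v)\<in>parcs T. real (geodesic_dist T r u) + real (geodesic_dist T r v)) =
    4 * (\<Sum>x\<in>pverts T. real (geodesic_dist T r x)) - 2 * (real (card (pverts T)) - 1)"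
proof -
  \<comment> \<open>The root would contribute \<open>2 * 0 - 1\<close>, so including it lowers the
    sum by 1.\<close>
  have "(\<Sum>x\<in>pverts T. 2 * real (geodesic_dist T r x) - 1) =
    -1 + (\<Sum>x\<in>pverts T - {r}. 2 * real (geodesic_dist T r x) - 1)"
    using r pair_finite_verts geodesic_dist_self by (subst sum.remove[of _ r]) simp_all
  then have "(\<Sum>x\<in>pverts T - {r}. 2 * real (geodesic_dist T r x) - 1) =
    2 * (\<Sum>x\<in>pverts T. real (geodesic_dist T r x)) - real (card (pverts T)) + 1"
    by (simp add: sum_subtractf sum_distrib_left)
  then show ?thesis
    using sum_parcs_level[OF level_function_geodesic_dist[OF r], of "\<lambda>t. t"]
    by (simp add: split_def)
qed

section \<open>Distances along a subdivided edge\<close>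

lemma geodesic_dist_subdivision_old:
  assumes "r \<in> pverts T" "x \<in> pverts T"
  shows "geodesic_dist (subdivision_tree m T) (Inl r) (Inl x) = (m + 1) * geodesic_dist T r x"
proof -
  interpret H: tree_graph "subdivision_tree m T" by (rule tree_graph_subdivision)
  show ?thesis
    using H.geodesic_dist_eq_level[OF level_function_subdivision[OF level_function_geodesic_dist]] assms
    by (simp add: subdivision_tree_def sub_level_def)
qed

text \<open>Distances from \<open>y\<close> are levels, and the positions strictly between
  \<open>j\<close> and \<open>m + 1\<close> avoid the root \<open>y\<close>, so the level is linear
  from \<open>j\<close> on. The choice \<open>j = 0\<close> serves a vertex \<open>y\<close> that is
  not new on this edge; for a new one, \<open>j\<close> is its own position.\<close>

lemma geodesic_dist_subdivision_ray:
  assumes uv: "(u, v) \<in> parcs T" and y: "y \<in> pverts (subdivision_tree m T)"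
    and j: "j \<le> m + 1" and inner: "\<And>i. j < i \<Longrightarrow> i \<le> m \<Longrightarrow> y \<noteq> sub_vertex m u v i"
  obtains s :: real where "s = 1 \<or> s = -1"
    "\<And>i. j \<le> i \<Longrightarrow> i \<le> m + 1 \<Longrightarrow>
       geodesic_dist (subdivision_tree m T) y (sub_vertex m u v i) =
       geodesic_dist (subdivision_tree m T) y (sub_vertex m u v j) + s * (real i - real j)"
proof -
  interpret H: tree_graph "subdivision_tree m T" by (rule tree_graph_subdivision)
  have inj: "sub_vertex m u v a = sub_vertex m u v b \<longleftrightarrow> a = b" if "a \<le> m + 1" "b \<le> m + 1" for a b
    using inj_on_eq_iff[OF sub_vertex_inj[OF uv, of m]] that by simp
  obtain s :: real where s: "s = 1 \<or> s = -1" and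
    lin: "\<And>i. i \<le> m + 1 - j \<Longrightarrow> geodesic_dist (subdivision_tree m T) y (sub_vertex m u v (j + i)) =
       geodesic_dist (subdivision_tree m T) y (sub_vertex m u v (j + 0)) + s * i"
  proof (rule H.level_function_along_path[OF H.level_function_geodesic_dist[OF y],
        of "m + 1 - j" "\<lambda>i. sub_vertex m u v (j + i)"])
    fix i assume i: "i < m + 1 - j"
    then have "j + i \<le> m" by simp
    then show "(sub_vertex m u v (j + i), sub_vertex m u v (j + Suc i)) \<in> parcs (subdivision_tree m T)"
      using uv unfolding subdivision_tree_def by auto
  next
    fix i assume i: "0 < i" "i < m + 1 - j"
    then have "j + i \<le> m" by simp
    then show "sub_vertex m u v (j + i) \<noteq> y \<and> sub_vertex m u v (j + (i - 1)) \<noteq> sub_vertex m u v (j + Suc i)"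
      using inner[of "j + i"] inj[of "j + (i - 1)" "j + Suc i"] i by auto
  next
    fix i a assume "0 < i" "i < m + 1 - j" "(a, sub_vertex m u v (j + i)) \<in> parcs (subdivision_tree m T)"
    then show "a = sub_vertex m u v (j + (i - 1)) \<or> a = sub_vertex m u v (j + Suc i)"
      using sub_vertex_neighbours[of a m u v "j + i"] by simp
  qed blast
  show thesis
  proof (rule that[OF s])
    fix i assume "j \<le> i" "i \<le> m + 1"
    then show "geodesic_dist (subdivision_tree m T) y (sub_vertex m u v i) =
       geodesic_dist (subdivision_tree m T) y (sub_vertex m u v j) + s * (real i - real j)"
      using lin[of "i - j"] by (simp add: of_nat_diff)
  qed
qed

lemma geodesic_dist_subdivision_same_edge:
  assumes uv: "(u, v) \<in> parcs T" and "i \<le> m + 1" "j \<le> m + 1"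
  shows "real (geodesic_dist (subdivision_tree m T) (sub_vertex m u v j) (sub_vertex m u v i)) =
    \<bar>real i - real j\<bar>"
proof -
  interpret H: tree_graph "subdivision_tree m T" by (rule tree_graph_subdivision)
  let ?d = "\<lambda>j i. geodesic_dist (subdivision_tree m T) (sub_vertex m u v j) (sub_vertex m u v i)"
  have V: "sub_vertex m u v i \<in> pverts (subdivision_tree m T)" if "i \<le> m + 1" for i
    using sub_vertex_in_pverts uv that by blast
  have le: "real (?d j i) = real i - real j" if ij: "j \<le> i" "i \<le> m + 1" for i j
  proof -
    have ne: "sub_vertex m u v j \<noteq> sub_vertex m u v k" if "j < k" "k \<le> m" for k
      using inj_on_eq_iff[OF sub_vertex_inj[OF uv, of m], of j k] that by simp
    have j: "j \<le> m + 1" using ij by simp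
    obtain s :: real where s: "s = 1 \<or> s = -1"
      and eq: "\<And>i. j \<le> i \<Longrightarrow> i \<le> m + 1 \<Longrightarrow> ?d j i = ?d j j + s * (real i - real j)"
      using geodesic_dist_subdivision_ray[OF uv V[OF j] j ne] by blast
    have "real (?d j i) = s * (real i - real j)"
      using eq[OF ij] H.geodesic_dist_self[OF V[of j]] ij by simp
    \<comment> \<open>Starting from distance 0, slope \<open>-1\<close> would lead to negative
      distances.\<close>
    moreover have "0 \<le> real (?d j i)" by simp
    ultimately show ?thesis using s ij by auto
  qed
  show ?thesis
  proof (cases "j \<le> i")
    case True
    then show ?thesis using le[OF True] assms(2) by simp
  next
    case False
    then have "?d j i = ?d i j" using H.geodesic_dist_sym[OF V V] assms(2,3) by blast
    then show ?thesis using le[of i j] False assms(3) by simp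
  qed
qed

section \<open>Distance sums over new vertices\<close>

lemma sum_geodesic_dist_new_vertices:
  assumes uv: "(u, v) \<in> parcs T" and y: "y \<in> pverts (subdivision_tree m T)"
    and "y \<notin> sub_vertex m u v ` {1..m}"
  shows "(\<Sum>i=1..m. real (geodesic_dist (subdivision_tree m T) y (sub_vertex m u v i))) =
    real m / 2 * (real (geodesic_dist (subdivision_tree m T) y (Inl u)) +
                  real (geodesic_dist (subdivision_tree m T) y (Inl v)))"
proof -
  let ?g = "\<lambda>i. geodesic_dist (subdivision_tree m T) y (sub_vertex m u v i)"
  have ne: "y \<noteq> sub_vertex m u v i" if "0 < i" "i \<le> m" for i using assms(3) that by auto
  obtain s :: real where
    lin0: "\<And>i. 0 \<le> i \<Longrightarrow> i \<le> m + 1 \<Longrightarrow> ?g i = ?g 0 + s * (real i - real 0)"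
    using geodesic_dist_subdivision_ray[OF uv y le0 ne] by blast
  have lin: "?g i = ?g 0 + s * real i" if "i \<le> m + 1" for i using lin0[OF le0 that] by simp
  have gauss: "(\<Sum>i=1..m. real i) = real m * (real m + 1) / 2"
    by (induction m) (simp_all add: field_simps)
  have "(\<Sum>i=1..m. real (?g i)) = (\<Sum>i=1..m. ?g 0 + s * real i)"
    by (intro sum.cong[OF refl] lin) simp
  also have "\<dots> = real m / 2 * (?g 0 + ?g (m + 1))"
    using lin[of "m + 1"] gauss by (simp add: sum.distrib sum_distrib_left[symmetric] field_simps)
  finally show ?thesis by (simp add: sub_vertex_def)
qed

text \<open>The progression formula fails only when \<open>y\<close> is a new vertex of this very
  edge. There it predicts \<open>m / 2 * (m + 1)\<close>, as the distances to both ends add up to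
  \<open>m + 1\<close>, while the true value is a row sum of
  \<open>\<bar>real i - real j\<bar>\<close>. The last term collects these defects.\<close>

lemma sum_geodesic_dist_new_vertices_total:
  fixes m :: nat
  defines "H \<equiv> subdivision_tree m T"
  assumes uv: "(u, v) \<in> parcs T"
  shows "(\<Sum>y\<in>pverts H. \<Sum>i=1..m. real (geodesic_dist H y (sub_vertex m u v i))) =
    real m / 2 * ((\<Sum>y\<in>pverts H. real (geodesic_dist H y (Inl u))) +
                  (\<Sum>y\<in>pverts H. real (geodesic_dist H y (Inl v))))
    - (real m ^ 2 * (real m + 1) / 2 - real m * (real m ^ 2 - 1) / 3)"
proof -
  interpret H: tree_graph H unfolding H_def by (rule tree_graph_subdivision)
  define g where "g y = (\<Sum>i=1..m. real (geodesic_dist H y (sub_vertex m u v i))) -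
    real m / 2 * (real (geodesic_dist H y (Inl u)) + real (geodesic_dist H y (Inl v)))" for y
  let ?I = "sub_vertex m u v ` {1..m}"
  have "?I \<subseteq> pverts H" using sub_vertex_in_pverts[OF uv] by (auto simp: H_def)
  then have "sum g (pverts H) = sum g ?I"
    using sum_geodesic_dist_new_vertices[OF uv] H.pair_finite_verts
    by (intro sum.mono_neutral_right) (auto simp: g_def H_def)
  also have "\<dots> = (\<Sum>j=1..m. g (sub_vertex m u v j))"
    using inj_on_subset[OF sub_vertex_inj[OF uv, of m], of "{1..m}"] by (simp add: sum.reindex)
  also have "\<dots> = (\<Sum>j=1..m. (\<Sum>i=1..m. \<bar>real i - real j\<bar>) - real m / 2 * (real m + 1))"
  proof (rule sum.cong[OF refl])
    fix j assume j: "j \<in> {1..m}"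
    have "geodesic_dist H (sub_vertex m u v j) (Inl u) + geodesic_dist H (sub_vertex m u v j) (Inl v)
      = real m + 1"
      using geodesic_dist_subdivision_same_edge[OF uv, of 0 m j]
        geodesic_dist_subdivision_same_edge[OF uv, of "m + 1" m j] j
      by (simp add: H_def sub_vertex_def)
    moreover have "(\<Sum>i=1..m. real (geodesic_dist H (sub_vertex m u v j) (sub_vertex m u v i))) =
      (\<Sum>i=1..m. \<bar>real i - real j\<bar>)"
      using geodesic_dist_subdivision_same_edge[OF uv] j by (intro sum.cong) (auto simp: H_def)
    ultimately show "g (sub_vertex m u v j) =
      (\<Sum>i=1..m. \<bar>real i - real j\<bar>) - real m / 2 * (real m + 1)"
      by (simp add: g_def)
  qed
  also have "\<dots> = real m * (real m ^ 2 - 1) / 3 - real m ^ 2 * (real m + 1) / 2"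
  proof -
    have "(\<Sum>j=1..m. \<Sum>i=1..m. \<bar>real i - real j\<bar>) = real m * (real m ^ 2 - 1) / 3"
      by (subst sum.swap) (rule sum_abs_diff)
    then show ?thesis by (simp add: sum_subtractf power2_eq_square)
  qed
  finally have "sum g (pverts H) = \<dots>" .
  then show ?thesis
    unfolding g_def sum_subtractf sum_distrib_left[symmetric] sum.distrib by linarith
qed

text \<open>Ordered pairs of vertices are counted by whether the second one is old or new. New ones
  are traded for the ends of their edges, so everything reduces to distance totals of old
  vertices.\<close>

lemma sum_geodesic_dist_subdivision:
  fixes m :: nat
  defines "H \<equiv> subdivision_tree m T"
  defines "n \<equiv> real (card (pverts T))"
  shows "real (geodesic_dist_sum H) = (real m + 1) ^ 3 * real (geodesic_dist_sum T)
    - n ^ 2 * real m * (real m + 1) ^ 2 / 2 + n * real m * (real m + 1) * (2 * real m + 1) / 3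
    - real m * (real m + 1) * (real m - 1) / 6"
proof -
  interpret H: tree_graph H unfolding H_def by (rule tree_graph_subdivision)
  let ?V = "pverts T" and ?E = "parcs T" and ?x = "sub_vertex m"
  let ?M = "real m"
  define d where "d u v = real (geodesic_dist T u v)" for u v
  define d' where "d' y z = real (geodesic_dist H y z)" for y z
  \<comment> \<open>\<open>D\<close> and \<open>B\<close> are the distance totals of an old vertex
    in \<open>T\<close> and in \<open>H\<close>, \<open>W\<close> is the sum over ordered pairs in
    \<open>T\<close>, and \<open>c\<close> is the correction for one arc.\<close>
  define D where "D u = (\<Sum>w\<in>?V. d w u)" for u
  define B where "B u = (\<Sum>y\<in>pverts H. d' y (Inl u))" for u
  define W where "W = (\<Sum>u\<in>?V. D u)"
  define c where "c = ?M ^ 2 * (?M + 1) / 2 - ?M * (?M ^ 2 - 1) / 3"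
  have d_sym: "d u v = d v u" if "u \<in> ?V" "v \<in> ?V" for u v
    using geodesic_dist_sym that by (simp add: d_def)
  have arcs_d: "(\<Sum>(a, b)\<in>?E. d u a + d u b) = 4 * D u - 2 * (n - 1)" if u: "u \<in> ?V" for u
  proof -
    have "D u = (\<Sum>w\<in>?V. d u w)" using d_sym u by (simp add: D_def)
    then show ?thesis using sum_parcs_geodesic_dist[OF u] by (simp add: d_def n_def)
  qed
  \<comment> \<open>An old vertex is never new on an edge, so the progression formula applies to
    every arc without correction.\<close>
  have B: "B u = (?M + 1) ^ 2 * D u - ?M * (?M + 1) * (n - 1) / 2" if u: "u \<in> ?V" for u
  proof -
    have Hu: "Inl u \<in> pverts H" using u by (auto simp: H_def subdivision_tree_def)
    have old: "d' (Inl u) (Inl w) = (?M + 1) * d u w" if "w \<in> ?V" for w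
      using geodesic_dist_subdivision_old[OF u that, of m]
      by (simp add: d'_def d_def H_def algebra_simps)
    have "B u = (\<Sum>y\<in>pverts H. d' (Inl u) y)"
      using H.geodesic_dist_sym Hu by (simp add: B_def d'_def)
    also have "\<dots> = (\<Sum>w\<in>?V. d' (Inl u) (Inl w))
      + (\<Sum>(a, b)\<in>?E. \<Sum>i=1..m. d' (Inl u) (?x a b i)) / 2"
      unfolding H_def by (rule sum_subdivision_vertices)
    also have "(\<Sum>(a, b)\<in>?E. \<Sum>i=1..m. d' (Inl u) (?x a b i)) =
      (\<Sum>(a, b)\<in>?E. ?M / 2 * (?M + 1) * (d u a + d u b))"
    proof (rule sum.cong[OF refl], clarify)
      fix a b assume ab: "(a, b) \<in> ?E"
      have "Inl u \<notin> ?x a b ` {1..m}" by (auto simp: sub_vertex_def)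
      then have "(\<Sum>i=1..m. d' (Inl u) (?x a b i)) = ?M / 2 * (d' (Inl u) (Inl a) + d' (Inl u) (Inl b))"
        using sum_geodesic_dist_new_vertices[OF ab, of "Inl u" m] Hu by (simp add: d'_def H_def)
      then show "(\<Sum>i=1..m. d' (Inl u) (?x a b i)) = ?M / 2 * (?M + 1) * (d u a + d u b)"
        using old in_arcsD1[OF ab] in_arcsD2[OF ab] by (simp add: algebra_simps)
    qed
    also have "\<dots> = ?M / 2 * (?M + 1) * (\<Sum>(a, b)\<in>?E. d u a + d u b)"
      by (simp add: sum_distrib_left split_def)
    also have "(\<Sum>w\<in>?V. d' (Inl u) (Inl w)) = (?M + 1) * D u"
      using old d_sym u by (simp add: D_def sum_distrib_left)
    finally show ?thesis using arcs_d[OF u] by (simp add: field_simps power2_eq_square)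
  qed
  have arcs_D: "(\<Sum>(a, b)\<in>?E. D a + D b) = 4 * W - 2 * n * (n - 1)"
  proof -
    have "(\<Sum>(a, b)\<in>?E. D a + D b) = (\<Sum>w\<in>?V. \<Sum>(a, b)\<in>?E. d w a + d w b)"
      by (subst sum.swap) (simp add: D_def sum.distrib split_def)
    also have "\<dots> = (\<Sum>w\<in>?V. 4 * D w - 2 * (n - 1))" using arcs_d by simp
    finally show ?thesis by (simp add: W_def n_def sum_subtractf sum_distrib_left)
  qed
  have arcs_B: "(\<Sum>(a, b)\<in>?E. B a + B b) =
    (?M + 1) ^ 2 * (4 * W - 2 * n * (n - 1)) - 2 * ?M * (?M + 1) * (n - 1) ^ 2"
  proof -
    have "(\<Sum>(a, b)\<in>?E. B a + B b) =
      (\<Sum>(a, b)\<in>?E. (?M + 1) ^ 2 * (D a + D b) - ?M * (?M + 1) * (n - 1))"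
      by (rule sum.cong) (auto simp: B in_arcsD1 in_arcsD2 algebra_simps)
    also have "\<dots> = (?M + 1) ^ 2 * (\<Sum>(a, b)\<in>?E. D a + D b)
      - real (card ?E) * (?M * (?M + 1) * (n - 1))"
      by (simp add: split_def sum_subtractf sum_distrib_left)
    finally show ?thesis using arcs_D card_parcs by (simp add: n_def power2_eq_square)
  qed
  have verts_B: "(\<Sum>u\<in>?V. B u) = (?M + 1) ^ 2 * W - n * (?M * (?M + 1) * (n - 1) / 2)"
    using B by (simp add: W_def n_def sum_subtractf sum_distrib_left)
  have "2 * real (geodesic_dist_sum H) = (\<Sum>y\<in>pverts H. \<Sum>z\<in>pverts H. d' y z)"
    using arg_cong[OF H.sum_geodesic_dist, of real] by (simp add: d'_def)
  also have "\<dots> = (\<Sum>y\<in>pverts H. (\<Sum>u\<in>?V. d' y (Inl u))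
      + (\<Sum>(a, b)\<in>?E. \<Sum>i=1..m. d' y (?x a b i)) / 2)"
    using sum_subdivision_vertices[where m = m] by (simp add: H_def)
  also have "\<dots> = (\<Sum>y\<in>pverts H. \<Sum>u\<in>?V. d' y (Inl u))
      + (\<Sum>y\<in>pverts H. \<Sum>(a, b)\<in>?E. \<Sum>i=1..m. d' y (?x a b i)) / 2"
    by (simp add: sum.distrib sum_divide_distrib)
  also have "(\<Sum>y\<in>pverts H. \<Sum>u\<in>?V. d' y (Inl u)) = (\<Sum>u\<in>?V. B u)"
    unfolding B_def by (rule sum.swap)
  \<comment> \<open>With the arc outermost, the inner sum runs over all vertices \<open>y\<close> of
    \<open>H\<close>, which is the total already known up to the correction
    \<open>c\<close>.\<close>
  also have "(\<Sum>y\<in>pverts H. \<Sum>(a, b)\<in>?E. \<Sum>i=1..m. d' y (?x a b i)) =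
      (\<Sum>(a, b)\<in>?E. \<Sum>y\<in>pverts H. \<Sum>i=1..m. d' y (?x a b i))"
    by (subst sum.swap) (simp add: split_def)
  also have "\<dots> = (\<Sum>(a, b)\<in>?E. ?M / 2 * (B a + B b) - c)"
    using sum_geodesic_dist_new_vertices_total[where m = m]
    by (intro sum.cong) (auto simp: B_def d'_def c_def H_def)
  also have "\<dots> = ?M / 2 * (\<Sum>(a, b)\<in>?E. B a + B b) - real (card ?E) * c"
    by (simp add: split_def sum_subtractf sum_distrib_left)
  finally have total: "2 * real (geodesic_dist_sum H) = (\<Sum>u\<in>?V. B u) +
      (?M / 2 * (\<Sum>(a, b)\<in>?E. B a + B b) - 2 * (n - 1) * c) / 2"
    using card_parcs by (simp add: n_def)
  have W: "W = 2 * real (geodesic_dist_sum T)"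
    unfolding W_def D_def using arg_cong[OF sum_geodesic_dist, of real]
    by (subst sum.swap) (simp add: d_def)
  show ?thesis
    using total unfolding verts_B arcs_B W c_def
    by (simp add: field_simps power2_eq_square power3_eq_cube)
qed

end

section \<open>Power sums and the stated form of the result\<close>

lemma sum_squares: "(\<Sum>i=1..m. real i ^ 2) = real m * (real m + 1) * (2 * real m + 1) / 6"
  by (induction m) (simp_all add: field_simps power2_eq_square)

lemma sum_cubes: "(\<Sum>i=1..m. real i ^ 3) = real m ^ 2 * (real m + 1) ^ 2 / 4"
  by (induction m) (simp_all add: field_simps power2_eq_square power3_eq_cube)

theorem theorem1:
  fixes T :: "'a pair_pre_digraph" and n m :: nat
  assumes "undirected_tree T"
    and "card (pverts T) = n"
    and "n \<ge> 2"
    and "m \<ge> 2"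
  shows "real (geodesic_dist_sum (subdivision_tree m T)) =
           (real m + 1) ^ 3 * real (geodesic_dist_sum T)
           - 2 * real n ^ 2 * (\<Sum>i=1..m. real i ^ 3) / real m
           + 2 * real n * (\<Sum>i=1..m. real i ^ 2)
           - (real m + 1) / (2 * real m - 1) * (\<Sum>i=1..m-1. real i ^ 2)"
proof -
  interpret tree_graph T
    using assms(1) by (simp add: tree_graph_def tree_graph_axioms_def undirected_tree_def)
  have "2 * real n ^ 2 * (\<Sum>i=1..m. real i ^ 3) / real m = real n ^ 2 * real m * (real m + 1) ^ 2 / 2"
    using assms(4) unfolding sum_cubes by (simp add: power2_eq_square)
  moreover have "2 * real n * (\<Sum>i=1..m. real i ^ 2) =
      real n * real m * (real m + 1) * (2 * real m + 1) / 3"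
    unfolding sum_squares by simp
  moreover have "(real m + 1) / (2 * real m - 1) * (\<Sum>i=1..m-1. real i ^ 2) =
      real m * (real m + 1) * (real m - 1) / 6"
  \<comment> \<open>The sum of squares up to \<open>m - 1\<close> carries the factor
    \<open>2 * real m - 1\<close>, which cancels the denominator.\<close>
  proof -
    have "2 * real m - 1 \<noteq> 0" using assms(4) by linarith
    moreover have eq: "(\<Sum>i=1..m-1. real i ^ 2) = (real m - 1) * real m * (2 * real m - 1) / 6"
      unfolding sum_squares using assms(4) by (simp add: of_nat_diff algebra_simps)
    ultimately show ?thesis unfolding eq by (simp add: field_simps)
  qed
  ultimately show ?thesis using sum_geodesic_dist_subdivision[of m] by (simp only: assms(2))
qed

end
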